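(* Let $\gamma,\lambda\in\mathbb R$ satisfy $\gamma<1$ and $\gamma+\lambda<1$. Let $K$ be a homogeneous symmetric coagulation kernel of homogeneity $\gamma$, continuous on $(0,\infty)^2$, satisfying the two-sided power-law bounds with parameters $\gamma,\lambda$ (see context). 1. If $\gamma\le-1$ and $\gamma+2\lambda>1$, then there is no self-similar profile $\Phi$ with respect to $K$ (see context). 2. If $\gamma\le-1$ and $\gamma+2\lambda=1$, then there is no self-similar profile $\Phi$ with respect to $K$ having the additional property $$\int_{(0,1]}x^{-\lambda}\,\Phi(\mathrm dx)<\infty.$$
   Context: Notation: $\mathbb R_*=(0,\infty)$; $\mathcal M_+(\mathbb R_* )$ is the set of non-negative Radon measures on $\mathbb R_*$; $C^1_c(\mathbb R_* )$ is the set of compactly supported $C^1$ functions on $\mathbb R_*$. Kernel assumptions: $K:(0,\infty)^2\to[0,\infty)$ is continuous, symmetric ($K(x,y)=K(y,x)$), homogeneous of degree $\gamma$ ($K(ax,ay)=a^\gamma K(x,y)$ for all $a,x,y>0$), and there are constants $0<c_2\le c_1<\infty$ with $$c_2\left[\frac{x^{\gamma+\lambda}}{y^{\lambda}}+\frac{y^{\gamma+\lambda}}{x^{\lambda}}\right]\le K(x,y)\le c_1\left[\frac{x^{\gamma+\lambda}}{y^{\lambda}}+\frac{y^{\gamma+\lambda}}{x^{\lambda}}\right]\quad\text{for all }x,y>0.$$ Self-similar profile (for $\gamma<1$, $\gamma+\lambda<1$, $\gamma+2\lambda\ge1$): a measure $\Phi\in\mathcal M_+(\mathbb R_* )$ such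 that $$0<\int_{\mathbb R_*}x^{\gamma+\lambda}\Phi(\mathrm dx)<\infty,\qquad \int_{(0,1)}x^{1-\lambda}\Phi(\mathrm dx)<\infty,$$ and for every $\varphi\in C^1_c(\mathbb R_* )$ $$\int_{\mathbb R_*}\varphi'(x)\left[\frac{2}{1-\gamma}x-\frac{x^{\gamma+\lambda}}{\int_{\mathbb R_*}z^{\gamma+\lambda}\Phi(\mathrm dz)}\right]\Phi(\mathrm dx)-\frac{1+\gamma}{1-\gamma}\int_{\mathbb R_*}\varphi(x)\Phi(\mathrm dx)=\frac12\int_{\mathbb R_*}\int_{\mathbb R_*}K(x,y)\,[\varphi(x+y)-\varphi(x)-\varphi(y)]\,\Phi(\mathrm dx)\Phi(\mathrm dy).$$ *)

theory Defs
  imports "HOL-Analysis.Analysis"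
begin

definition coagulation_kernel :: "real \<Rightarrow> real \<Rightarrow> (real \<Rightarrow> real \<Rightarrow> real) \<Rightarrow> bool" where
  "coagulation_kernel \<gamma> lam K \<longleftrightarrow>
     (\<forall>x>0. \<forall>y>0. 0 \<le> K x y) \<and>
     continuous_on ({0<..} \<times> {0<..}) (\<lambda>(x, y). K x y) \<and>
     (\<forall>x>0. \<forall>y>0. K x y = K y x) \<and>
     (\<forall>a>0. \<forall>x>0. \<forall>y>0. K (a * x) (a * y) = a powr \<gamma> * K x y) \<and>
     (\<exists>c1 c2. 0 < c2 \<and> c2 \<le> c1 \<and>
        (\<forall>x>0. \<forall>y>0.
           c2 * (x powr (\<gamma> + lam) / y powr lam + y powr (\<gamma> + lam) / x powr lam) \<le> K x y \<and>
           K x y \<le> c1 * (x powr (\<gamma> + lam) / y powr lam + y powr (\<gamma> + lam) / x powr lam)))"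

text \<open>
  Non-negative Radon measures on the open half-line. The first condition forces the underlying
  space to be \<open>{0<..}\<close>. Regularity need not be required: a Borel measure on a \<open>\<sigma>\<close>-compact metric
  space that is finite on compact sets is automatically regular.
\<close>

definition radon_measure_pos :: "real measure \<Rightarrow> bool" where
  "radon_measure_pos \<Phi> \<longleftrightarrow>
     sets \<Phi> = sets (restrict_space borel {0<..}) \<and>
     (\<forall>C. compact C \<and> C \<subseteq> {0<..} \<longrightarrow> emeasure \<Phi> C < \<infinity>)"

text \<open>
  Compactly supported \<open>C\<^sup>1\<close> functions on the open half-line, as functions on the reals whose values
  on \<open>{..0}\<close> are irrelevant. The inclusion keeps the support away from \<open>0\<close>.
\<close>

definition C1_compact_support_pos :: "(real \<Rightarrow> real) \<Rightarrow> bool" where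
  "C1_compact_support_pos \<phi> \<longleftrightarrow>
     \<phi> C1_differentiable_on {0<..} \<and>
     compact (closure (support_on {0<..} \<phi>)) \<and>
     closure (support_on {0<..} \<phi>) \<subseteq> {0<..}"

text \<open>
  If \<open>\<gamma> + 2 * lam \<ge> 1\<close> and \<open>K\<close> is a coagulation kernel, the two moment conditions
  make all integrals in the weak equation absolutely convergent, so the Bochner integrals there
  never take their default value \<open>0\<close>.
\<close>

definition self_similar_profile ::
  "real \<Rightarrow> real \<Rightarrow> (real \<Rightarrow> real \<Rightarrow> real) \<Rightarrow> real measure \<Rightarrow> bool" where
  "self_similar_profile \<gamma> lam K \<Phi> \<longleftrightarrow>
     radon_measure_pos \<Phi> \<and>
     0 < (\<integral>\<^sup>+ x. ennreal (x powr (\<gamma> + lam)) \<partial>\<Phi>) \<and>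
     (\<integral>\<^sup>+ x. ennreal (x powr (\<gamma> + lam)) \<partial>\<Phi>) < \<infinity> \<and>
     (\<integral>\<^sup>+ x\<in>{0<..<1}. ennreal (x powr (1 - lam)) \<partial>\<Phi>) < \<infinity> \<and>
     (\<forall>\<phi>. C1_compact_support_pos \<phi> \<longrightarrow>
        (\<integral>x. deriv \<phi> x *
            (2 / (1 - \<gamma>) * x - x powr (\<gamma> + lam) / (\<integral>z. z powr (\<gamma> + lam) \<partial>\<Phi>)) \<partial>\<Phi>)
          - (1 + \<gamma>) / (1 - \<gamma>) * (\<integral>x. \<phi> x \<partial>\<Phi>)
        = 1 / 2 * (\<integral>x. (\<integral>y. K x y * (\<phi> (x + y) - \<phi> x - \<phi> y) \<partial>\<Phi>) \<partial>\<Phi>))"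

end

theory Submission
  imports Defs
begin

text \<open>
  Put \<open>s = \<gamma> + lam\<close> and \<open>b = - (1 + \<gamma>) / 2 \<ge> 0\<close>, and test the weak equation with
  \<open>\<phi> x = x / (x + \<epsilon>) * (1 + x) powr (- b)\<close>. Since \<open>\<phi> x / x\<close> is decreasing, \<open>\<phi>\<close> is subadditive, so
  the coagulation term is a genuine loss. On the other side \<open>x * \<phi>' x + b * \<phi> x \<ge> 0\<close>, and the only
  term that can balance the loss is the flux at the origin, at most a multiple of
  \<open>\<integral>x powr s * (\<epsilon> / (x + \<epsilon>)\<^sup>2) \<partial>\<Phi>\<close>. The loss is at least a fixed multiple of
  \<open>\<integral>x powr (1 - lam) / (x + \<epsilon>) \<partial>\<Phi>\<close> (up to weights at infinity). If \<open>\<gamma> + 2 * lam > 1\<close>,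
  then \<open>x powr s\<close> is negligible against \<open>x powr (1 - lam)\<close> near \<open>0\<close>, so the flux is absorbed by the
  loss up to \<open>O(\<epsilon>)\<close>. If \<open>\<gamma> + 2 * lam = 1\<close>, the additional moment makes the flux vanish as \<open>\<epsilon> \<rightarrow> 0\<close>.
  In both cases a loss that stays bounded away from \<open>0\<close> would be at most \<open>0\<close>.
\<close>

section \<open>Logarithmic cutoffs\<close>

text \<open>The square smooths the kink of the positive part: at \<open>0\<close> the difference
  quotient is at most \<open>\<bar>h\<bar>\<close>. This is what makes the cutoffs below C1.\<close>

lemma DERIV_max_0_square:
  "((\<lambda>x::real. (max 0 x)\<^sup>2) has_real_derivative 2 * max 0 x) (at x)"
proof (cases x "0 :: real" rule: linorder_cases)
  case less
  have "((\<lambda>x::real. 0) has_real_derivative 0) (at x)" by simp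
  then have "((\<lambda>x::real. (max 0 x)\<^sup>2) has_real_derivative 0) (at x)"
    by (rule has_field_derivative_transform_within_open[where S = "{..<0}"]) (use less in auto)
  with less show ?thesis by simp
next
  case equal
  have "((\<lambda>h::real. (max 0 h)\<^sup>2 / h) \<longlongrightarrow> 0) (at 0)"
  proof (rule Lim_null_comparison)
    show "\<forall>\<^sub>F h::real in at 0. norm ((max 0 h)\<^sup>2 / h) \<le> \<bar>h\<bar>"
      by (intro always_eventually) (auto simp: power2_eq_square max_def)
    show "((\<lambda>h::real. \<bar>h\<bar>) \<longlongrightarrow> 0) (at 0)" by (intro tendsto_eq_intros) auto
  qed
  with equal show ?thesis by (simp add: DERIV_def)
next
  case greater
  have "((\<lambda>x::real. x\<^sup>2) has_real_derivative 2 * x) (at x)"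
    by (auto intro!: derivative_eq_intros)
  then have "((\<lambda>x::real. (max 0 x)\<^sup>2) has_real_derivative 2 * x) (at x)"
    by (rule has_field_derivative_transform_within_open[where S = "{0<..}"]) (use greater in auto)
  with greater show ?thesis by simp
qed

text \<open>In the variable \<open>t = ln x / N\<close> this is the bump
  \<open>(1 - t\<^sup>2)\<^sup>2\<close> on \<open>[-1, 1]\<close>, extended by zero. The
  logarithmic scale cuts off at \<open>0\<close> and at infinity simultaneously and keeps
  \<open>x\<close> times the derivative of size \<open>O(1 / N)\<close> at every scale.\<close>

definition log_cutoff :: "real \<Rightarrow> real \<Rightarrow> real" where
  "log_cutoff N x = (max 0 (1 - (ln x / N)\<^sup>2))\<^sup>2"

definition log_cutoff_deriv :: "real \<Rightarrow> real \<Rightarrow> real" where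
  "log_cutoff_deriv N x = - 4 * (ln x / N) * max 0 (1 - (ln x / N)\<^sup>2) / (N * x)"

lemma DERIV_log_cutoff:
  assumes "N > 0" "x > 0"
  shows "(log_cutoff N has_real_derivative log_cutoff_deriv N x) (at x)"
proof -
  have "((\<lambda>x. 1 - (ln x / N)\<^sup>2) has_real_derivative - 2 * (ln x / N) / (N * x)) (at x)"
    using assms by (auto intro!: derivative_eq_intros simp: field_simps power2_eq_square)
  from DERIV_chain2[OF DERIV_max_0_square this] show ?thesis
    by (simp add: log_cutoff_def[abs_def] log_cutoff_deriv_def mult_ac)
qed

lemma log_cutoff_nonneg: "0 \<le> log_cutoff N x"
  by (simp add: log_cutoff_def)

lemma log_cutoff_le_1: "log_cutoff N x \<le> 1"
  unfolding log_cutoff_def by (intro power_le_one) auto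

lemma log_cutoff_deriv_bound:
  assumes "N > 0" "x > 0"
  shows "\<bar>x * log_cutoff_deriv N x\<bar> \<le> 4 / N"
proof -
  define t where "t = ln x / N"
  have "\<bar>t\<bar> * max 0 (1 - t\<^sup>2) \<le> 1 * 1"
  proof (cases "\<bar>t\<bar> \<le> 1")
    case True
    then show ?thesis by (intro mult_mono) auto
  next
    case False
    then have "1 \<le> \<bar>t\<bar>\<^sup>2" by (intro one_le_power) simp
    then show ?thesis by simp
  qed
  then have "4 / N * (\<bar>t\<bar> * max 0 (1 - t\<^sup>2)) \<le> 4 / N * 1"
    using assms by (intro mult_left_mono) auto
  moreover have "\<bar>x * log_cutoff_deriv N x\<bar> = 4 / N * (\<bar>t\<bar> * max 0 (1 - t\<^sup>2))"
    using assms unfolding log_cutoff_deriv_def t_def[symmetric] by (simp add: abs_mult)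
  ultimately show ?thesis by simp
qed

lemma log_cutoff_tendsto: "(\<lambda>n. log_cutoff (real (Suc n)) x) \<longlonglongrightarrow> 1"
proof -
  have "(\<lambda>n. ln x / real (Suc n)) \<longlonglongrightarrow> 0"
    using LIMSEQ_Suc lim_const_over_n by blast
  then have "(\<lambda>n. (max 0 (1 - (ln x / real (Suc n))\<^sup>2))\<^sup>2) \<longlonglongrightarrow> (max 0 (1 - 0\<^sup>2))\<^sup>2"
    by (intro tendsto_intros)
  then show ?thesis by (simp add: log_cutoff_def)
qed

lemma log_cutoff_deriv_tendsto:
  assumes "x > 0"
  shows "(\<lambda>n. log_cutoff_deriv (real (Suc n)) x) \<longlonglongrightarrow> 0"
proof (rule Lim_null_comparison)
  have "norm (log_cutoff_deriv (real (Suc n)) x) \<le> 4 / x / real (Suc n)" for n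
    using log_cutoff_deriv_bound[of "real (Suc n)" x] assms
    by (simp add: abs_mult pos_le_divide_eq mult_ac del: of_nat_Suc)
  then show "\<forall>\<^sub>F n in sequentially. norm (log_cutoff_deriv (real (Suc n)) x) \<le> 4 / x / real (Suc n)"
    by simp
  show "(\<lambda>n. 4 / x / real (Suc n)) \<longlonglongrightarrow> 0"
    using LIMSEQ_Suc lim_const_over_n by blast
qed

lemma continuous_on_log_cutoff [continuous_intros]:
  "N > 0 \<Longrightarrow> continuous_on {0<..} (log_cutoff N)"
  unfolding log_cutoff_def[abs_def] by (intro continuous_intros) auto

lemma continuous_on_log_cutoff_deriv [continuous_intros]:
  "N > 0 \<Longrightarrow> continuous_on {0<..} (log_cutoff_deriv N)"
  unfolding log_cutoff_deriv_def[abs_def] by (intro continuous_intros) auto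

text \<open>A C1 function becomes an admissible test function after multiplication by the cutoff,
  because the support is confined to \<open>{exp (- N)..exp N}\<close>, a compact interval away from
  \<open>0\<close>.\<close>

lemma C1_compact_support_pos_mult_log_cutoff:
  assumes N: "N > 0"
    and deriv: "\<And>x. x > 0 \<Longrightarrow> (f has_real_derivative f' x) (at x)"
    and cont: "continuous_on {0<..} f'"
  shows "C1_compact_support_pos (\<lambda>x. f x * log_cutoff N x)"
proof -
  let ?D = "\<lambda>x. f' x * log_cutoff N x + f x * log_cutoff_deriv N x"
  have f: "continuous_on {0<..} f"
    by (intro continuous_at_imp_continuous_on) (auto intro: DERIV_isCont deriv)
  have "((\<lambda>x. f x * log_cutoff N x) has_vector_derivative ?D x) (at x)" if "x > 0" for x
    using DERIV_mult[OF deriv[OF that] DERIV_log_cutoff[OF N that]]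
    by (simp add: has_real_derivative_iff_has_vector_derivative add.commute mult.commute)
  moreover have "continuous_on {0<..} ?D"
    using f cont N by (intro continuous_intros)
  ultimately have C1: "(\<lambda>x. f x * log_cutoff N x) C1_differentiable_on {0<..}"
    unfolding C1_differentiable_on_def by (intro exI[of _ ?D]) auto
  let ?I = "{exp (- N)..exp N}"
  have "x \<in> ?I" if "x > 0" "log_cutoff N x \<noteq> 0" for x
  proof -
    from that have "(ln x / N)\<^sup>2 < 1"
      by (auto simp: log_cutoff_def max_def split: if_splits)
    then have "\<bar>ln x / N\<bar> < 1" by (simp add: abs_square_less_1)
    then have "- N \<le> ln x" "ln x \<le> N" using N by (auto simp: abs_less_iff field_simps)
    then have "exp (- N) \<le> exp (ln x)" "exp (ln x) \<le> exp N" by simp_all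
    then show ?thesis using that by simp
  qed
  then have "support_on {0<..} (\<lambda>x. f x * log_cutoff N x) \<subseteq> ?I"
    by (auto simp: support_on_def)
  then have cl: "closure (support_on {0<..} (\<lambda>x. f x * log_cutoff N x)) \<subseteq> ?I"
    by (rule closure_minimal) simp
  then have "compact (closure (support_on {0<..} (\<lambda>x. f x * log_cutoff N x)))"
    by (meson bounded_closed_interval bounded_subset closed_closure compact_eq_bounded_closed)
  moreover have "?I \<subseteq> {0<..}"
    by (auto intro: less_le_trans[OF exp_gt_zero])
  ultimately show ?thesis
    using C1 cl by (auto simp: C1_compact_support_pos_def)
qed

section \<open>The weak equation for functions without compact support\<close>

text \<open>Extended by zero outside \<open>A \<times> A\<close>, \<open>f\<close> is Borel on the
  whole plane. Composing with the measurable inclusion of the product space recovers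
  \<open>f\<close>, since that space consists of points of \<open>A \<times> A\<close> only.\<close>

lemma borel_measurable_pair_continuous_on:
  fixes f :: "real \<times> real \<Rightarrow> real"
  assumes M: "sets M = sets (restrict_space borel A)"
    and A: "A \<in> sets borel"
    and f: "continuous_on (A \<times> A) f"
  shows "f \<in> borel_measurable (M \<Otimes>\<^sub>M M)"
proof -
  have space: "space M = A"
    using sets_eq_imp_space_eq[OF M] by (simp add: space_restrict_space)
  have "(\<lambda>x. x) \<in> borel_measurable M"
    unfolding measurable_cong_sets[OF M refl] by (rule borel_measurable_continuous_on_restrict) simp
  then have "(\<lambda>z. (fst z, snd z)) \<in> M \<Otimes>\<^sub>M M \<rightarrow>\<^sub>M borel"
    unfolding borel_prod[symmetric]
    by (intro measurable_Pair measurable_compose[OF measurable_fst] measurable_compose[OF measurable_snd])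
  moreover have "(\<lambda>z. indicator (A \<times> A) z *\<^sub>R f z) \<in> borel_measurable borel"
    using A f by (intro borel_measurable_continuous_on_indicator) (auto simp: borel_prod[symmetric])
  ultimately have "(\<lambda>z. indicator (A \<times> A) (fst z, snd z) *\<^sub>R f (fst z, snd z)) \<in> borel_measurable (M \<Otimes>\<^sub>M M)"
    by (rule measurable_compose)
  then show ?thesis
    by (rule measurable_cong[THEN iffD1, rotated]) (auto simp: space_pair_measure space)
qed

text \<open>If \<open>x\<close> is the smaller argument, the defect is
  \<open>f (x + y) - f y\<close> minus \<open>f x\<close>. The Lipschitz bound controls the first
  part and the linear bound the second, each by \<open>C * x\<close>. The factor
  \<open>min x y\<close> is what later compensates the singularity of the kernel.\<close>

lemma subadditivity_defect_bound:
  fixes f :: "real \<Rightarrow> real"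
  assumes deriv: "\<And>x. x > 0 \<Longrightarrow> (f has_real_derivative f' x) (at x)"
    and f': "\<And>x. x > 0 \<Longrightarrow> \<bar>f' x\<bar> \<le> C"
    and f: "\<And>x. x > 0 \<Longrightarrow> \<bar>f x\<bar> \<le> C * x"
    and "x > 0" "y > 0"
  shows "\<bar>f (x + y) - f x - f y\<bar> \<le> 2 * C * min x y"
proof -
  have lip: "\<bar>f (u + v) - f v\<bar> \<le> C * u" if "u > 0" "v > 0" for u v
  proof -
    have "norm (f (u + v) - f v) \<le> C * norm (u + v - v)"
      by (rule field_differentiable_bound[where S = "{0<..}" and f' = f'])
         (use that deriv f' in \<open>auto intro: has_field_derivative_at_within\<close>)
    then show ?thesis using that by simp
  qed
  show ?thesis
    using lip[of x y] lip[of y x] f[of x] f[of y] assms(4,5)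
    by (cases "x \<le> y") (auto simp: add.commute abs_le_iff)
qed

section \<open>The profile measure and its finite moments\<close>

locale self_similar =
  fixes \<gamma> lam c1 c2 :: real and K :: "real \<Rightarrow> real \<Rightarrow> real" and \<Phi> :: "real measure"
  assumes gamma_le: "\<gamma> \<le> -1" and gamma_lam_less: "\<gamma> + lam < 1" and gamma_lam_ge: "\<gamma> + 2 * lam \<ge> 1"
    and K_cont: "continuous_on ({0<..} \<times> {0<..}) (\<lambda>(x, y). K x y)"
    and c2_pos: "c2 > 0"
    and K_ge: "\<And>x y. x > 0 \<Longrightarrow> y > 0 \<Longrightarrow>
      c2 * (x powr (\<gamma> + lam) / y powr lam + y powr (\<gamma> + lam) / x powr lam) \<le> K x y"
    and K_le: "\<And>x y. x > 0 \<Longrightarrow> y > 0 \<Longrightarrow>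
      K x y \<le> c1 * (x powr (\<gamma> + lam) / y powr lam + y powr (\<gamma> + lam) / x powr lam)"
    and profile: "self_similar_profile \<gamma> lam K \<Phi>"
begin

definition "s = \<gamma> + lam"
definition "M = (\<integral>x. x powr s \<partial>\<Phi>)"
definition "A = (\<integral>x. x powr (1 - lam) \<partial>\<Phi>)"

lemma sets_Phi: "sets \<Phi> = sets (restrict_space borel {0<..})"
  using profile by (simp add: self_similar_profile_def radon_measure_pos_def)

lemma space_Phi: "space \<Phi> = {0<..}"
  using sets_eq_imp_space_eq[OF sets_Phi] by (simp add: space_restrict_space)

lemma AE_Phi_pos: "(\<And>x. x > 0 \<Longrightarrow> P x) \<Longrightarrow> AE x in \<Phi>. P x"
  by (rule AE_I2) (simp add: space_Phi)

lemma borel_measurable_Phi: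
  fixes f :: "real \<Rightarrow> real"
  assumes "continuous_on {0<..} f"
  shows "f \<in> borel_measurable \<Phi>"
  unfolding measurable_cong_sets[OF sets_Phi refl]
  using assms by (rule borel_measurable_continuous_on_restrict)

lemma borel_measurable_Phi_pair:
  fixes f :: "real \<Rightarrow> real \<Rightarrow> real"
  assumes "continuous_on ({0<..} \<times> {0<..}) (\<lambda>(x, y). f x y)"
  shows "(\<lambda>(x, y). f x y) \<in> borel_measurable (\<Phi> \<Otimes>\<^sub>M \<Phi>)"
  using sets_Phi _ assms by (rule borel_measurable_pair_continuous_on) simp

text \<open>The compact intervals \<open>{1 / real (Suc n)..real (Suc n)}\<close> have finite
  measure and exhaust the half-line. Sigma-finiteness is what makes the inner coagulation integral a
  measurable function of \<open>x\<close>.\<close>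

sublocale sigma_finite_measure \<Phi>
proof
  let ?I = "\<lambda>n. {1 / real (Suc n)..real (Suc n)}"
  have sub: "?I n \<subseteq> {0<..}" for n
    by (auto intro: less_le_trans[rotated])
  have "emeasure \<Phi> (?I n) < \<infinity>" for n
    using profile sub[of n]
    by (auto simp: self_similar_profile_def radon_measure_pos_def simp del: of_nat_Suc)
  moreover have "?I n \<in> sets \<Phi>" for n
    using sub[of n] by (simp add: sets_Phi sets_restrict_space_iff del: of_nat_Suc)
  moreover have "(\<Union>n. ?I n) = {0<..}"
  proof (intro equalityI subsetI)
    fix x :: real assume "x \<in> {0<..}"
    moreover obtain n where "max x (1 / x) < real n" using reals_Archimedean2 by blast
    ultimately have n: "max x (1 / x) < real n" "x > 0" by auto
    then have "1 / x \<le> real (Suc n)" "x \<le> real (Suc n)" by auto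
    with n(2) have "x \<in> ?I n" by (simp add: field_simps)
    then show "x \<in> (\<Union>n. ?I n)" by blast
  qed (use sub in blast)
  ultimately show "\<exists>A. countable A \<and> A \<subseteq> sets \<Phi> \<and> \<Union> A = space \<Phi> \<and> (\<forall>a\<in>A. emeasure \<Phi> a \<noteq> \<infinity>)"
    by (intro exI[of _ "range ?I"]) (auto simp: space_Phi less_top)
qed

lemma integrable_Phi_bound:
  fixes f g :: "real \<Rightarrow> real"
  assumes "continuous_on {0<..} f" "integrable \<Phi> g" "\<And>x. x > 0 \<Longrightarrow> \<bar>f x\<bar> \<le> g x"
  shows "integrable \<Phi> f"
  by (rule Bochner_Integration.integrable_bound[OF assms(2) borel_measurable_Phi[OF assms(1)]])
     (use assms(3) in \<open>force intro!: AE_Phi_pos\<close>)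

lemma continuous_on_powr_pos: "continuous_on {0<..} (\<lambda>x::real. x powr r)"
  by (intro continuous_intros) auto

lemma integrable_s: "integrable \<Phi> (\<lambda>x. x powr s)"
  using profile
  by (intro integrableI_nonneg borel_measurable_Phi continuous_on_powr_pos)
     (auto simp: self_similar_profile_def s_def)

lemma M_pos: "M > 0"
proof -
  have "ennreal M = (\<integral>\<^sup>+ x. ennreal (x powr s) \<partial>\<Phi>)"
    unfolding M_def by (rule nn_integral_eq_integral[OF integrable_s, symmetric]) simp
  then have "0 < ennreal M"
    using profile by (simp add: self_similar_profile_def s_def)
  then show ?thesis by simp
qed

text \<open>On \<open>{0<..<1}\<close> this is the second moment condition of the profile. For
  \<open>x \<ge> 1\<close> the assumption \<open>\<gamma> + 2 * lam \<ge> 1\<close> gives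
  \<open>1 - lam \<le> s\<close>, so the moment of order \<open>s\<close> takes care of the
  tail.\<close>

lemma integrable_lam: "integrable \<Phi> (\<lambda>x. x powr (1 - lam))"
proof (rule integrable_Phi_bound)
  let ?g = "\<lambda>x. x powr (1 - lam) * indicator {0<..<1} x :: real"
  have meas: "?g \<in> borel_measurable \<Phi>"
    by (intro borel_measurable_times borel_measurable_Phi continuous_on_powr_pos borel_measurable_indicator)
       (auto simp: sets_Phi sets_restrict_space_iff)
  have "(\<integral>\<^sup>+ x. ennreal (?g x) \<partial>\<Phi>) = (\<integral>\<^sup>+ x\<in>{0<..<1}. ennreal (x powr (1 - lam)) \<partial>\<Phi>)"
    by (intro nn_integral_cong) (auto simp: indicator_def)
  with profile have "integrable \<Phi> ?g"
    by (intro integrableI_nonneg meas) (auto simp: self_similar_profile_def)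
  with integrable_s show "integrable \<Phi> (\<lambda>x. ?g x + x powr s)"
    by (intro Bochner_Integration.integrable_add)
  fix x :: real assume "x > 0"
  moreover have "x powr (1 - lam) \<le> x powr s" if "x \<ge> 1"
    using that gamma_lam_ge by (intro powr_mono) (auto simp: s_def)
  ultimately show "\<bar>x powr (1 - lam)\<bar> \<le> ?g x + x powr s"
    by (cases "x < 1") auto
qed (rule continuous_on_powr_pos)

section \<open>Domination of the coagulation term by products of moments\<close>

lemma K_nonneg: "x > 0 \<Longrightarrow> y > 0 \<Longrightarrow> 0 \<le> K x y"
  using c2_pos by (intro order_trans[OF _ K_ge]) auto

text \<open>In the upper kernel bound, \<open>min x y\<close> is replaced by \<open>y\<close> in the
  summand divided by \<open>y powr lam\<close> and by \<open>x\<close> in the other one. Each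
  summand then splits into a product of two powers with finite moments.\<close>

lemma K_mult_min_le:
  assumes "x > 0" "y > 0"
  shows "K x y * min x y \<le> c1 * (x powr s * y powr (1 - lam) + x powr (1 - lam) * y powr s)"
proof -
  let ?a = "x powr s / y powr lam" and ?b = "y powr s / x powr lam"
  \<comment> \<open>The sign of \<open>c1\<close> comes from comparing the two kernel bounds: they
    force \<open>c2 \<le> c1\<close>.\<close>
  have "0 < x powr s / y powr lam + y powr s / x powr lam" using assms by (simp add: add_pos_pos)
  moreover have "c2 * (?a + ?b) \<le> c1 * (?a + ?b)"
    using K_ge[OF assms] K_le[OF assms] by (simp add: s_def)
  ultimately have c1: "c1 \<ge> 0" using c2_pos by (simp add: mult_le_cancel_right)
  have "K x y * min x y \<le> c1 * (?a + ?b) * min x y"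
    using K_le[OF assms] assms by (intro mult_right_mono) (auto simp: s_def)
  also have "\<dots> = c1 * (?a * min x y + ?b * min x y)" by (simp add: algebra_simps)
  also have "\<dots> \<le> c1 * (?a * y + ?b * x)"
    using c1 assms by (intro mult_left_mono add_mono) auto
  also have "?a * y + ?b * x = x powr s * y powr (1 - lam) + x powr (1 - lam) * y powr s"
    using assms by (simp add: powr_diff)
  finally show ?thesis .
qed

lemma integrable_K_majorant_inner:
  "integrable \<Phi> (\<lambda>y. c1 * (x powr s * y powr (1 - lam) + x powr (1 - lam) * y powr s))"
  using integrable_s integrable_lam by auto

lemma integral_K_majorant_inner:
  "(\<integral>y. c1 * (x powr s * y powr (1 - lam) + x powr (1 - lam) * y powr s) \<partial>\<Phi>)
    = c1 * (x powr s * A + x powr (1 - lam) * M)"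
  using integrable_s integrable_lam by (simp add: A_def M_def)

lemma coagulation_integrand_bound:
  fixes f :: "real \<Rightarrow> real"
  assumes "\<bar>f (x + y) - f x - f y\<bar> \<le> B * min x y" and xy: "x > 0" "y > 0"
  shows "\<bar>K x y * (f (x + y) - f x - f y)\<bar>
    \<le> B * (c1 * (x powr s * y powr (1 - lam) + x powr (1 - lam) * y powr s))"
proof -
  \<comment> \<open>The sign of \<open>B\<close> is forced by the defect bound at this single
    pair.\<close>
  have "0 \<le> B * min x y" by (rule order_trans[OF abs_ge_zero assms(1)])
  moreover have "0 < min x y" using xy by simp
  ultimately have "B \<ge> 0" by (simp only: zero_le_mult_iff) linarith
  have "\<bar>K x y * (f (x + y) - f x - f y)\<bar> \<le> K x y * (B * min x y)"
    unfolding abs_mult using K_nonneg[OF xy] assms(1) by (simp add: mult_left_mono)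
  also have "\<dots> = B * (K x y * min x y)" by simp
  also have "\<dots> \<le> B * (c1 * (x powr s * y powr (1 - lam) + x powr (1 - lam) * y powr s))"
    using K_mult_min_le[OF xy] \<open>B \<ge> 0\<close> by (rule mult_left_mono)
  finally show ?thesis .
qed

lemma
  fixes f :: "real \<Rightarrow> real"
  assumes f: "continuous_on {0<..} f"
  shows continuous_on_coagulation_integrand:
      "x > 0 \<Longrightarrow> continuous_on {0<..} (\<lambda>y. K x y * (f (x + y) - f x - f y))"
    and borel_measurable_coagulation_integral:
      "(\<lambda>x. \<integral>y. K x y * (f (x + y) - f x - f y) \<partial>\<Phi>) \<in> borel_measurable \<Phi>"
proof -
  have cont: "continuous_on ({0<..} \<times> {0<..}) (\<lambda>(x, y). K x y * (f (x + y) - f x - f y))"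
    unfolding case_prod_beta
    by (intro continuous_intros continuous_on_compose2[OF f] K_cont[unfolded case_prod_beta]) auto
  from borel_measurable_Phi_pair[OF this]
  show "(\<lambda>x. \<integral>y. K x y * (f (x + y) - f x - f y) \<partial>\<Phi>) \<in> borel_measurable \<Phi>"
    by (rule borel_measurable_lebesgue_integral)
  assume "x > 0"
  then have "continuous_on {0<..} (\<lambda>y. (\<lambda>(x, y). K x y * (f (x + y) - f x - f y)) (x, y))"
    by (intro continuous_on_compose2[OF cont] continuous_intros) auto
  then show "continuous_on {0<..} (\<lambda>y. K x y * (f (x + y) - f x - f y))" by simp
qed

text \<open>Integrating the majorant over \<open>y\<close> gives
  \<open>B * (c1 * (x powr s * A + x powr (1 - lam) * M))\<close>, again a combination of the two
  integrable powers. Hence the inner and the outer integral are dominated by the same two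
  moments.\<close>

lemma
  fixes f :: "real \<Rightarrow> real"
  assumes f: "continuous_on {0<..} f"
    and defect: "\<And>x y. x > 0 \<Longrightarrow> y > 0 \<Longrightarrow> \<bar>f (x + y) - f x - f y\<bar> \<le> B * min x y"
  shows integrable_coagulation_integrand:
      "x > 0 \<Longrightarrow> integrable \<Phi> (\<lambda>y. K x y * (f (x + y) - f x - f y))"
    and coagulation_integral_bound:
      "x > 0 \<Longrightarrow> \<bar>\<integral>y. K x y * (f (x + y) - f x - f y) \<partial>\<Phi>\<bar>
         \<le> B * (c1 * (x powr s * A + x powr (1 - lam) * M))"
    and integrable_coagulation_integral:
      "integrable \<Phi> (\<lambda>x. \<integral>y. K x y * (f (x + y) - f x - f y) \<partial>\<Phi>)"
proof -
  let ?g = "\<lambda>x y. B * (c1 * (x powr s * y powr (1 - lam) + x powr (1 - lam) * y powr s))"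
  have g: "integrable \<Phi> (?g x)" for x
    by (intro integrable_mult_right integrable_K_majorant_inner)
  show inner: "integrable \<Phi> (\<lambda>y. K x y * (f (x + y) - f x - f y))" if "x > 0" for x
    using continuous_on_coagulation_integrand[OF f that] g[of x]
      coagulation_integrand_bound[of f, OF defect[OF that] that]
    by (rule integrable_Phi_bound)
  show bound: "\<bar>\<integral>y. K x y * (f (x + y) - f x - f y) \<partial>\<Phi>\<bar>
         \<le> B * (c1 * (x powr s * A + x powr (1 - lam) * M))" if "x > 0" for x
  proof -
    have "norm (\<integral>y. K x y * (f (x + y) - f x - f y) \<partial>\<Phi>) \<le> (\<integral>y. ?g x y \<partial>\<Phi>)"
      by (rule Bochner_Integration.integral_norm_bound_integral[OF inner[OF that] g])
         (use coagulation_integrand_bound[of f, OF defect[OF that] that] in \<open>auto simp: space_Phi\<close>)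
    also have "\<dots> = B * (c1 * (x powr s * A + x powr (1 - lam) * M))"
      using integral_K_majorant_inner[of x] by simp
    finally show ?thesis by simp
  qed
  have "integrable \<Phi> (\<lambda>x. B * (c1 * (x powr s * A + x powr (1 - lam) * M)))"
    using integrable_s integrable_lam by auto
  then show "integrable \<Phi> (\<lambda>x. \<integral>y. K x y * (f (x + y) - f x - f y) \<partial>\<Phi>)"
    by (rule Bochner_Integration.integrable_bound)
       (use bound in \<open>force intro!: AE_Phi_pos borel_measurable_coagulation_integral f\<close>)+
qed

text \<open>Dominated convergence is applied twice, to the outer integral and, for fixed
  \<open>x\<close>, to the inner one. Both majorants are independent of \<open>n\<close> because the
  constant \<open>B\<close> is.\<close>

lemma coagulation_integral_tendsto:
  fixes F :: "nat \<Rightarrow> real \<Rightarrow> real" and f :: "real \<Rightarrow> real"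
  assumes F: "\<And>n. continuous_on {0<..} (F n)" and f: "continuous_on {0<..} f"
    and defect: "\<And>n x y. x > 0 \<Longrightarrow> y > 0 \<Longrightarrow> \<bar>F n (x + y) - F n x - F n y\<bar> \<le> B * min x y"
    and lim: "\<And>x. x > 0 \<Longrightarrow> (\<lambda>n. F n x) \<longlonglongrightarrow> f x"
  shows "(\<lambda>n. \<integral>x. (\<integral>y. K x y * (F n (x + y) - F n x - F n y) \<partial>\<Phi>) \<partial>\<Phi>)
    \<longlonglongrightarrow> (\<integral>x. (\<integral>y. K x y * (f (x + y) - f x - f y) \<partial>\<Phi>) \<partial>\<Phi>)"
proof (rule integral_dominated_convergence)
  show "(\<lambda>x. \<integral>y. K x y * (f (x + y) - f x - f y) \<partial>\<Phi>) \<in> borel_measurable \<Phi>"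
    "\<And>n. (\<lambda>x. \<integral>y. K x y * (F n (x + y) - F n x - F n y) \<partial>\<Phi>) \<in> borel_measurable \<Phi>"
    by (intro borel_measurable_coagulation_integral f F)+
  show "integrable \<Phi> (\<lambda>x. B * (c1 * (x powr s * A + x powr (1 - lam) * M)))"
    using integrable_s integrable_lam by auto
  show "AE x in \<Phi>. norm (\<integral>y. K x y * (F n (x + y) - F n x - F n y) \<partial>\<Phi>)
      \<le> B * (c1 * (x powr s * A + x powr (1 - lam) * M))" for n
    unfolding real_norm_def by (intro AE_Phi_pos coagulation_integral_bound F defect)
  show "AE x in \<Phi>. (\<lambda>n. \<integral>y. K x y * (F n (x + y) - F n x - F n y) \<partial>\<Phi>)
      \<longlonglongrightarrow> (\<integral>y. K x y * (f (x + y) - f x - f y) \<partial>\<Phi>)"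
  proof (rule AE_Phi_pos, rule integral_dominated_convergence)
    fix x :: real assume x: "x > 0"
    show "(\<lambda>y. K x y * (f (x + y) - f x - f y)) \<in> borel_measurable \<Phi>"
      "\<And>n. (\<lambda>y. K x y * (F n (x + y) - F n x - F n y)) \<in> borel_measurable \<Phi>"
      by (intro borel_measurable_Phi continuous_on_coagulation_integrand f F x)+
    show "integrable \<Phi> (\<lambda>y. B * (c1 * (x powr s * y powr (1 - lam) + x powr (1 - lam) * y powr s)))"
      by (intro integrable_mult_right integrable_K_majorant_inner)
    show "AE y in \<Phi>. norm (K x y * (F n (x + y) - F n x - F n y))
        \<le> B * (c1 * (x powr s * y powr (1 - lam) + x powr (1 - lam) * y powr s))" for n
      unfolding real_norm_def by (intro AE_Phi_pos coagulation_integrand_bound defect x)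
    show "AE y in \<Phi>. (\<lambda>n. K x y * (F n (x + y) - F n x - F n y))
        \<longlonglongrightarrow> K x y * (f (x + y) - f x - f y)"
      using x by (intro AE_Phi_pos tendsto_intros lim) auto
  qed
qed

text \<open>The two powers in the bound \<open>K_mult_min_le\<close> are both \<open>\<Phi>\<close>-integrable, so a uniform Lipschitz
  bound on the cut-off functions suffices for dominated convergence.\<close>

lemma weak_equation:
  fixes f f' :: "real \<Rightarrow> real"
  assumes deriv: "\<And>x. x > 0 \<Longrightarrow> (f has_real_derivative f' x) (at x)"
    and cont: "continuous_on {0<..} f'"
    and f_x: "\<And>x. x > 0 \<Longrightarrow> \<bar>f x\<bar> \<le> C * x"
    and f_s: "\<And>x. x > 0 \<Longrightarrow> \<bar>f x\<bar> \<le> C * x powr s"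
    and f'_1: "\<And>x. x > 0 \<Longrightarrow> \<bar>f' x\<bar> \<le> C"
    and f'_s: "\<And>x. x > 0 \<Longrightarrow> \<bar>x * f' x\<bar> \<le> C * x powr s"
  shows "(\<integral>x. f' x * (2 / (1 - \<gamma>) * x - x powr s / M) \<partial>\<Phi>)
      - (1 + \<gamma>) / (1 - \<gamma>) * (\<integral>x. f x \<partial>\<Phi>)
    = 1 / 2 * (\<integral>x. (\<integral>y. K x y * (f (x + y) - f x - f y) \<partial>\<Phi>) \<partial>\<Phi>)"
proof -
  have f: "continuous_on {0<..} f"
    by (intro continuous_at_imp_continuous_on) (auto intro: DERIV_isCont deriv)
  \<comment> \<open>The index \<open>Suc n\<close> keeps the cutoff parameter positive already at
    \<open>n = 0\<close>.\<close>
  define h where "h n = log_cutoff (real (Suc n))" for n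
  define h' where "h' n = log_cutoff_deriv (real (Suc n))" for n
  define F where "F n x = f x * h n x" for n x
  define F' where "F' n x = f' x * h n x + f x * h' n x" for n x
  have F_deriv: "(F n has_real_derivative F' n x) (at x)" if "x > 0" for n x
    unfolding F_def[abs_def] F'_def h_def h'_def
    using DERIV_mult[OF deriv[OF that] DERIV_log_cutoff[OF _ that, of "real (Suc n)"]]
    by (simp add: add.commute mult.commute)
  have F_cont: "continuous_on {0<..} (F n)" and F'_cont: "continuous_on {0<..} (F' n)" for n
    unfolding F_def[abs_def] F'_def[abs_def] h_def h'_def
    by (intro continuous_intros f cont; simp)+
  have chi: "0 \<le> h n x" "h n x \<le> 1" for n x
    by (simp_all add: h_def log_cutoff_nonneg log_cutoff_le_1)
  have chi': "\<bar>h' n x\<bar> \<le> 4 / x" if "x > 0" for n x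
  proof -
    have "\<bar>x * h' n x\<bar> \<le> 4 / real (Suc n)"
      unfolding h'_def using that by (intro log_cutoff_deriv_bound) auto
    also have "\<dots> \<le> 4" by (simp add: divide_le_eq)
    finally show ?thesis using that by (simp add: abs_mult pos_le_divide_eq mult.commute)
  qed
  have F_le: "\<bar>F n x\<bar> \<le> \<bar>f x\<bar>" for n x
    using chi[of n x] by (simp add: F_def abs_mult mult_left_le)
  have F'_le: "\<bar>F' n x\<bar> \<le> \<bar>f' x\<bar> + \<bar>f x\<bar> * (4 / x)" if "x > 0" for n x
  proof -
    have "\<bar>F' n x\<bar> \<le> \<bar>f' x * h n x\<bar> + \<bar>f x * h' n x\<bar>"
      unfolding F'_def by (rule abs_triangle_ineq)
    also have "\<dots> \<le> \<bar>f' x\<bar> + \<bar>f x\<bar> * (4 / x)"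
      using chi[of n x] chi'[OF that, of n] unfolding abs_mult
      by (intro add_mono mult_left_mono) (auto simp: mult_left_le)
    finally show ?thesis .
  qed
  \<comment> \<open>The constant is \<open>5 = 1 + 4\<close>: one \<open>C\<close> from
    \<open>f'\<close>, and four from \<open>f\<close> times the derivative of the cutoff, which is
    at most \<open>4 / x\<close>.\<close>
  have F'_1: "\<bar>F' n x\<bar> \<le> 5 * C" if "x > 0" for n x
  proof -
    have "\<bar>f x\<bar> * (4 / x) \<le> C * x * (4 / x)"
      using f_x[OF that] that by (intro mult_right_mono) auto
    then show ?thesis using F'_le[OF that, of n] f'_1[OF that] that by simp
  qed
  have F'_s: "\<bar>x * F' n x\<bar> \<le> 5 * C * x powr s" if "x > 0" for n x
  proof -
    have "\<bar>x * F' n x\<bar> \<le> x * (\<bar>f' x\<bar> + \<bar>f x\<bar> * (4 / x))"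
      unfolding abs_mult using F'_le[OF that, of n] that by (simp add: mult_left_mono)
    also have "\<dots> = \<bar>x * f' x\<bar> + 4 * \<bar>f x\<bar>"
      using that by (simp add: abs_mult field_simps)
    finally show ?thesis using f'_s[OF that] f_s[OF that] by simp
  qed
  have C: "C \<ge> 0" using f'_1[of 1] by simp
  have F_x: "\<bar>F n x\<bar> \<le> 5 * C * x" if "x > 0" for n x
    using F_le[of n x] f_x[OF that] mult_nonneg_nonneg[OF C, of x] that by linarith
  have F_lim: "(\<lambda>n. F n x) \<longlonglongrightarrow> f x" if "x > 0" for x
    using tendsto_mult[OF tendsto_const log_cutoff_tendsto[of x], of "f x"]
    by (simp add: F_def h_def)
  have F'_lim: "(\<lambda>n. F' n x) \<longlonglongrightarrow> f' x" if "x > 0" for x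
    using tendsto_add[OF tendsto_mult[OF tendsto_const log_cutoff_tendsto[of x], of "f' x"]
        tendsto_mult[OF tendsto_const log_cutoff_deriv_tendsto[OF that], of "f x"]]
    by (simp add: F'_def h_def h'_def)
  have lim_drift: "(\<lambda>n. \<integral>x. F' n x * (2 / (1 - \<gamma>) * x - x powr s / M) \<partial>\<Phi>)
      \<longlonglongrightarrow> (\<integral>x. f' x * (2 / (1 - \<gamma>) * x - x powr s / M) \<partial>\<Phi>)"
  proof (rule integral_dominated_convergence)
    have drift: "continuous_on {0<..} (\<lambda>x. 2 / (1 - \<gamma>) * x - x powr s / M)"
      using M_pos by (intro continuous_intros continuous_on_powr_pos) auto
    show "(\<lambda>x. f' x * (2 / (1 - \<gamma>) * x - x powr s / M)) \<in> borel_measurable \<Phi>"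
      "\<And>n. (\<lambda>x. F' n x * (2 / (1 - \<gamma>) * x - x powr s / M)) \<in> borel_measurable \<Phi>"
      by (intro borel_measurable_Phi continuous_on_mult cont F'_cont drift)+
    show "integrable \<Phi> (\<lambda>x. (2 / (1 - \<gamma>) + 1 / M) * (5 * C) * x powr s)"
      using integrable_s by simp
    show "AE x in \<Phi>. norm (F' n x * (2 / (1 - \<gamma>) * x - x powr s / M))
        \<le> (2 / (1 - \<gamma>) + 1 / M) * (5 * C) * x powr s" for n
    proof (rule AE_Phi_pos)
      fix x :: real assume x: "x > 0"
      \<comment> \<open>The two parts of the drift call for different bounds: the linear part uses
        the weighted bound \<open>F'_s\<close>, the power part the uniform bound
        \<open>F'_1\<close>. Both end in a multiple of \<open>x powr s\<close>.\<close>
      have "\<bar>F' n x * (2 / (1 - \<gamma>) * x - x powr s / M)\<bar>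
          = \<bar>2 / (1 - \<gamma>) * (x * F' n x) - F' n x * (x powr s / M)\<bar>"
        by (simp add: algebra_simps)
      also have "\<dots> \<le> \<bar>2 / (1 - \<gamma>) * (x * F' n x)\<bar> + \<bar>F' n x * (x powr s / M)\<bar>"
        by (rule abs_triangle_ineq4)
      also have "\<dots> = 2 / (1 - \<gamma>) * \<bar>x * F' n x\<bar> + \<bar>F' n x\<bar> * (x powr s / M)"
        using M_pos gamma_le by (simp add: abs_mult)
      also have "\<dots> \<le> 2 / (1 - \<gamma>) * (5 * C * x powr s) + 5 * C * (x powr s / M)"
        using M_pos gamma_le F'_s[OF x, of n] F'_1[OF x, of n]
        by (intro add_mono mult_left_mono mult_right_mono) auto
      finally show "norm (F' n x * (2 / (1 - \<gamma>) * x - x powr s / M))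
        \<le> (2 / (1 - \<gamma>) + 1 / M) * (5 * C) * x powr s"
        by (simp add: algebra_simps)
    qed
    show "AE x in \<Phi>. (\<lambda>n. F' n x * (2 / (1 - \<gamma>) * x - x powr s / M))
        \<longlonglongrightarrow> f' x * (2 / (1 - \<gamma>) * x - x powr s / M)"
      by (intro AE_Phi_pos tendsto_mult F'_lim tendsto_const)
  qed
  have lim_mass: "(\<lambda>n. \<integral>x. F n x \<partial>\<Phi>) \<longlonglongrightarrow> (\<integral>x. f x \<partial>\<Phi>)"
  proof (rule integral_dominated_convergence)
    show "f \<in> borel_measurable \<Phi>" by (rule borel_measurable_Phi[OF f])
    show "F n \<in> borel_measurable \<Phi>" for n by (rule borel_measurable_Phi[OF F_cont])
    show "integrable \<Phi> (\<lambda>x. C * x powr s)" using integrable_s by simp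
    show "AE x in \<Phi>. norm (F n x) \<le> C * x powr s" for n
      unfolding real_norm_def by (rule AE_Phi_pos) (rule order_trans[OF F_le f_s])
    show "AE x in \<Phi>. (\<lambda>n. F n x) \<longlonglongrightarrow> f x" by (intro AE_Phi_pos F_lim)
  qed
  have lim_coag: "(\<lambda>n. \<integral>x. (\<integral>y. K x y * (F n (x + y) - F n x - F n y) \<partial>\<Phi>) \<partial>\<Phi>)
      \<longlonglongrightarrow> (\<integral>x. (\<integral>y. K x y * (f (x + y) - f x - f y) \<partial>\<Phi>) \<partial>\<Phi>)"
    by (rule coagulation_integral_tendsto[OF F_cont f
          subadditivity_defect_bound[OF F_deriv F'_1 F_x] F_lim])
  have eq: "(\<integral>x. F' n x * (2 / (1 - \<gamma>) * x - x powr s / M) \<partial>\<Phi>)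
      - (1 + \<gamma>) / (1 - \<gamma>) * (\<integral>x. F n x \<partial>\<Phi>)
    = 1 / 2 * (\<integral>x. (\<integral>y. K x y * (F n (x + y) - F n x - F n y) \<partial>\<Phi>) \<partial>\<Phi>)" for n
  proof -
    have "C1_compact_support_pos (F n)"
      unfolding F_def[abs_def] h_def
      by (rule C1_compact_support_pos_mult_log_cutoff[OF _ deriv cont]) auto
    then have "(\<integral>x. deriv (F n) x * (2 / (1 - \<gamma>) * x - x powr s / M) \<partial>\<Phi>)
      - (1 + \<gamma>) / (1 - \<gamma>) * (\<integral>x. F n x \<partial>\<Phi>)
      = 1 / 2 * (\<integral>x. (\<integral>y. K x y * (F n (x + y) - F n x - F n y) \<partial>\<Phi>) \<partial>\<Phi>)"
      using profile by (simp add: self_similar_profile_def s_def M_def)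
    moreover have "(\<integral>x. deriv (F n) x * (2 / (1 - \<gamma>) * x - x powr s / M) \<partial>\<Phi>)
        = (\<integral>x. F' n x * (2 / (1 - \<gamma>) * x - x powr s / M) \<partial>\<Phi>)"
      by (intro Bochner_Integration.integral_cong)
         (auto simp: space_Phi DERIV_imp_deriv[OF F_deriv])
    ultimately show ?thesis by simp
  qed
  have "(\<lambda>n. (\<integral>x. F' n x * (2 / (1 - \<gamma>) * x - x powr s / M) \<partial>\<Phi>)
      - (1 + \<gamma>) / (1 - \<gamma>) * (\<integral>x. F n x \<partial>\<Phi>))
    \<longlonglongrightarrow> (\<integral>x. f' x * (2 / (1 - \<gamma>) * x - x powr s / M) \<partial>\<Phi>)
      - (1 + \<gamma>) / (1 - \<gamma>) * (\<integral>x. f x \<partial>\<Phi>)"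
    by (intro tendsto_intros lim_drift lim_mass)
  moreover have "(\<lambda>n. (\<integral>x. F' n x * (2 / (1 - \<gamma>) * x - x powr s / M) \<partial>\<Phi>)
      - (1 + \<gamma>) / (1 - \<gamma>) * (\<integral>x. F n x \<partial>\<Phi>))
    \<longlonglongrightarrow> 1 / 2 * (\<integral>x. (\<integral>y. K x y * (f (x + y) - f x - f y) \<partial>\<Phi>) \<partial>\<Phi>)"
    unfolding eq by (intro tendsto_intros lim_coag)
  ultimately show ?thesis by (rule LIMSEQ_unique)
qed

section \<open>Balance of flux and loss\<close>

text \<open>This \<open>b\<close> makes the drift and mass terms combine to \<open>2 / (1 - \<gamma>) * (x * \<phi>' x + b * \<phi> x)\<close>, and
  \<open>- b \<le> s\<close> keeps \<open>x powr (- b)\<close> integrable at infinity.\<close>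

definition "b = - (1 + \<gamma>) / 2"
definition "w x = (1 + x) powr (- b)" for x :: real
definition "test \<epsilon> x = x / (x + \<epsilon>) * w x" for \<epsilon> x :: real
text \<open>The derivative is written as \<open>test\<close> times its logarithmic derivative, so
  that bounds on \<open>test\<close> carry over directly.\<close>

definition "test' \<epsilon> x = test \<epsilon> x * (\<epsilon> / (x * (x + \<epsilon>)) - b / (1 + x))" for \<epsilon> x :: real
text \<open>\<open>J\<close> is the \<open>y\<close>-factor that remains when the loss is bounded
  below by a product. In \<open>\<kappa>\<close>, the \<open>1 / 2\<close> is that of the
  coagulation term and \<open>M\<close> clears the factor \<open>1 / M\<close> of the flux.\<close>

definition "J = (\<integral>y. y powr s * (y / (y + 2)) \<partial>\<Phi>)"
definition "\<kappa> = c2 * J * M / 2"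

lemma b_nonneg: "b \<ge> 0"
  using gamma_le by (simp add: b_def)

lemma minus_b_le_s: "- b \<le> s"
  using gamma_lam_ge by (simp add: b_def s_def field_simps)

lemma s_less_1: "s < 1"
  using gamma_lam_less by (simp add: s_def)

lemma w_pos: "x > 0 \<Longrightarrow> w x > 0"
  by (simp add: w_def)

lemma w_le_1: "x > 0 \<Longrightarrow> w x \<le> 1"
  using powr_mono[of "- b" 0 "1 + x"] b_nonneg by (simp add: w_def)

lemma w_antimono: "0 < x \<Longrightarrow> x \<le> y \<Longrightarrow> w y \<le> w x"
  unfolding w_def using b_nonneg by (intro powr_mono2') auto

lemma continuous_on_w [continuous_intros]: "continuous_on {0<..} w"
  unfolding w_def[abs_def] by (intro continuous_intros) auto

text \<open>A vanishing integral of a positive function would make almost every statement about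
  \<open>\<Phi>\<close> true, in particular \<open>x powr s = 0\<close>, against
  \<open>M > 0\<close>.\<close>

lemma integral_pos:
  fixes g :: "real \<Rightarrow> real"
  assumes g: "integrable \<Phi> g" and pos: "\<And>x. x > 0 \<Longrightarrow> g x > 0"
  shows "0 < (\<integral>x. g x \<partial>\<Phi>)"
proof -
  have nonneg: "AE x in \<Phi>. 0 \<le> g x"
    using pos by (intro AE_Phi_pos less_imp_le)
  have "(\<integral>x. g x \<partial>\<Phi>) \<noteq> 0"
  proof
    assume "(\<integral>x. g x \<partial>\<Phi>) = 0"
    then have "AE x in \<Phi>. g x = 0"
      using integral_nonneg_eq_0_iff_AE[OF g nonneg] by simp
    moreover have "AE x in \<Phi>. g x > 0" using pos by (rule AE_Phi_pos)
    ultimately have "AE x in \<Phi>. x powr s = 0" by eventually_elim simp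
    then have "M = 0" unfolding M_def by (rule integral_eq_zero_AE)
    with M_pos show False by simp
  qed
  moreover have "0 \<le> (\<integral>x. g x \<partial>\<Phi>)" using nonneg by (rule integral_nonneg_AE)
  ultimately show ?thesis by simp
qed

lemma integrable_J: "integrable \<Phi> (\<lambda>y. y powr s * (y / (y + 2)))"
proof (rule integrable_Phi_bound[OF _ integrable_s])
  show "continuous_on {0<..} (\<lambda>y. y powr s * (y / (y + 2)))"
    by (intro continuous_intros) auto
  fix y :: real assume "y > 0"
  then show "\<bar>y powr s * (y / (y + 2))\<bar> \<le> y powr s"
    using mult_left_le[of "y / (y + 2)" "y powr s"] by (simp add: abs_mult)
qed

lemma kappa_pos: "\<kappa> > 0"
proof -
  have "J > 0" unfolding J_def by (rule integral_pos[OF integrable_J]) simp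
  then show ?thesis using c2_pos M_pos by (simp add: \<kappa>_def)
qed

section \<open>Regularity of the test function\<close>

lemma DERIV_test:
  assumes "\<epsilon> > 0" "x > 0"
  shows "(test \<epsilon> has_real_derivative test' \<epsilon> x) (at x)"
proof -
  have "((\<lambda>x. x / (x + \<epsilon>)) has_real_derivative \<epsilon> / (x + \<epsilon>)\<^sup>2) (at x)"
    using assms by (auto intro!: derivative_eq_intros simp: power2_eq_square)
  moreover have "\<epsilon> / (x + \<epsilon>)\<^sup>2 = x / (x + \<epsilon>) * (\<epsilon> / (x * (x + \<epsilon>)))"
    using assms by (simp add: power2_eq_square)
  ultimately have 1: "((\<lambda>x. x / (x + \<epsilon>)) has_real_derivative
      x / (x + \<epsilon>) * (\<epsilon> / (x * (x + \<epsilon>)))) (at x)"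
    by simp
  have "((\<lambda>x. (1 + x) powr (- b)) has_real_derivative - b * (1 + x) powr (- b - 1)) (at x)"
    using assms by (auto intro!: derivative_eq_intros)
  moreover have "- b * (1 + x) powr (- b - 1) = w x * (- b / (1 + x))"
    using assms by (simp add: w_def powr_diff)
  ultimately have 2: "(w has_real_derivative w x * (- b / (1 + x))) (at x)"
    by (simp add: w_def[abs_def])
  show ?thesis
    using DERIV_mult[OF 1 2] by (simp add: test_def[abs_def] test'_def algebra_simps)
qed

lemma continuous_on_test [continuous_intros]: "\<epsilon> > 0 \<Longrightarrow> continuous_on {0<..} (test \<epsilon>)"
  unfolding test_def[abs_def] by (intro continuous_intros) auto

lemma continuous_on_test' [continuous_intros]: "\<epsilon> > 0 \<Longrightarrow> continuous_on {0<..} (test' \<epsilon>)"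
  unfolding test'_def[abs_def] by (intro continuous_intros) auto

section \<open>Estimates at a fixed regularisation \<open>\<epsilon>\<close>\<close>

context
  fixes \<epsilon> :: real
  assumes eps: "0 < \<epsilon>" "\<epsilon> \<le> 1"
begin

lemma test_nonneg: "x > 0 \<Longrightarrow> 0 \<le> test \<epsilon> x"
  using eps w_pos[of x] by (simp add: test_def)

lemma test_le_linear:
  assumes "x > 0" shows "test \<epsilon> x \<le> x / \<epsilon>"
proof -
  have "test \<epsilon> x \<le> x / (x + \<epsilon>) * 1"
    unfolding test_def using assms eps w_le_1[OF assms] by (intro mult_left_mono) auto
  also have "\<dots> \<le> x / \<epsilon>"
    using assms eps by (simp add: frac_le)
  finally show ?thesis .
qed

text \<open>Near the origin the linear bound suffices because \<open>s < 1\<close>. Beyond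
  \<open>1\<close> the weight gives decay \<open>x powr (- b)\<close>, and
  \<open>- b \<le> s\<close>.\<close>

lemma test_le_powr:
  assumes "x > 0" shows "test \<epsilon> x \<le> x powr s / \<epsilon>"
proof (cases "x \<le> 1")
  case True
  have "x powr 1 \<le> x powr s"
    using True assms s_less_1 by (intro powr_mono') auto
  then have "x / \<epsilon> \<le> x powr s / \<epsilon>"
    using assms eps by (simp add: divide_right_mono)
  with test_le_linear[OF assms] show ?thesis by simp
next
  case False
  have "test \<epsilon> x \<le> 1 * w x"
    unfolding test_def using assms eps w_pos[OF assms] by (intro mult_right_mono) auto
  also have "\<dots> \<le> x powr (- b)"
    unfolding w_def using assms b_nonneg by (simp add: powr_mono2')
  also have "\<dots> \<le> x powr s"
    using False minus_b_le_s by (intro powr_mono) auto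
  also have "\<dots> \<le> x powr s / \<epsilon>"
    using eps mult_left_le[of \<epsilon> "x powr s"] by (simp add: pos_le_divide_eq)
  finally show ?thesis .
qed

lemma mult_test'_eq:
  assumes "x > 0" shows "x * test' \<epsilon> x = test \<epsilon> x * (\<epsilon> / (x + \<epsilon>) - b * (x / (1 + x)))"
  using assms eps by (simp add: test'_def right_diff_distrib)

text \<open>The bracket in \<open>mult_test'_eq\<close> is a number in \<open>[0, 1]\<close> minus a
  number in \<open>[0, b]\<close>.\<close>

lemma mult_test'_bound:
  assumes "x > 0" shows "\<bar>x * test' \<epsilon> x\<bar> \<le> (1 + b) * test \<epsilon> x"
proof -
  have "\<bar>\<epsilon> / (x + \<epsilon>) - b * (x / (1 + x))\<bar> \<le> 1 + b"
  proof -
    have "0 \<le> \<epsilon> / (x + \<epsilon>)" "\<epsilon> / (x + \<epsilon>) \<le> 1" using assms eps by auto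
    moreover have "0 \<le> b * (x / (1 + x))" using assms b_nonneg by simp
    moreover have "b * (x / (1 + x)) \<le> b" using assms b_nonneg by (intro mult_left_le) auto
    ultimately show ?thesis by linarith
  qed
  from mult_left_mono[OF this test_nonneg[OF assms]] show ?thesis
    using test_nonneg[OF assms] by (simp only: mult_test'_eq[OF assms] abs_mult abs_of_nonneg mult.commute)
qed

text \<open>These are the size hypotheses of \<open>weak_equation\<close> with the common constant
  \<open>(1 + b) / \<epsilon>\<close>. Its growth as \<open>\<epsilon>\<close> tends to
  \<open>0\<close> is harmless, since the weak equation is only used at fixed
  \<open>\<epsilon>\<close>.\<close>

lemma test_bounds:
  assumes "x > 0"
  shows "\<bar>test \<epsilon> x\<bar> \<le> (1 + b) / \<epsilon> * x" "\<bar>test \<epsilon> x\<bar> \<le> (1 + b) / \<epsilon> * x powr s"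
    "\<bar>test' \<epsilon> x\<bar> \<le> (1 + b) / \<epsilon>" "\<bar>x * test' \<epsilon> x\<bar> \<le> (1 + b) / \<epsilon> * x powr s"
proof -
  have le: "z \<le> (1 + b) * z" if "z \<ge> 0" for z
    using that b_nonneg by (simp add: algebra_simps)
  show "\<bar>test \<epsilon> x\<bar> \<le> (1 + b) / \<epsilon> * x"
    using test_nonneg[OF assms] test_le_linear[OF assms] le[of "x / \<epsilon>"] assms eps by simp
  show "\<bar>test \<epsilon> x\<bar> \<le> (1 + b) / \<epsilon> * x powr s"
    using test_nonneg[OF assms] test_le_powr[OF assms] le[of "x powr s / \<epsilon>"] assms eps by simp
  have "\<bar>x * test' \<epsilon> x\<bar> \<le> (1 + b) * (x / \<epsilon>)"
    by (rule order_trans[OF mult_test'_bound[OF assms]])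
       (use test_le_linear[OF assms] b_nonneg in \<open>simp only: mult_left_mono add_nonneg_nonneg zero_le_one\<close>)
  then have "x * \<bar>test' \<epsilon> x\<bar> \<le> x * ((1 + b) / \<epsilon>)"
    using assms by (simp add: abs_mult mult.commute)
  then show "\<bar>test' \<epsilon> x\<bar> \<le> (1 + b) / \<epsilon>"
    using assms by (simp only: mult_le_cancel_left_pos)
  have "\<bar>x * test' \<epsilon> x\<bar> \<le> (1 + b) * (x powr s / \<epsilon>)"
    by (rule order_trans[OF mult_test'_bound[OF assms]])
       (use test_le_powr[OF assms] b_nonneg in \<open>simp only: mult_left_mono add_nonneg_nonneg zero_le_one\<close>)
  then show "\<bar>x * test' \<epsilon> x\<bar> \<le> (1 + b) / \<epsilon> * x powr s" by simp
qed

text \<open>The quotient \<open>test \<epsilon> z / z\<close> decreases in \<open>z\<close>.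
  Splitting \<open>test \<epsilon> (x + y)\<close> in the ratio \<open>x : y\<close>, the
  \<open>y\<close>-share is at most \<open>test \<epsilon> y\<close>. The gap is what the
  \<open>x\<close>-share loses when the denominator grows from \<open>x + \<epsilon>\<close> to
  \<open>x + y + \<epsilon>\<close>.\<close>

lemma test_subadditive_gap:
  assumes "x > 0" "y > 0"
  shows "x / (x + \<epsilon>) * w x * (y / (x + y + \<epsilon>)) \<le> test \<epsilon> x + test \<epsilon> y - test \<epsilon> (x + y)"
proof -
  have "y / (x + y + \<epsilon>) * w (x + y) \<le> test \<epsilon> y"
    unfolding test_def using assms eps w_antimono[of y "x + y"] w_pos[of "x + y"]
    by (intro mult_mono) (auto simp: frac_le)
  moreover have "x / (x + y + \<epsilon>) * w (x + y) \<le> x / (x + y + \<epsilon>) * w x"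
    using assms eps w_antimono[of x "x + y"] by (intro mult_left_mono) auto
  moreover have "test \<epsilon> (x + y) = x / (x + y + \<epsilon>) * w (x + y) + y / (x + y + \<epsilon>) * w (x + y)"
    by (simp add: test_def add_divide_distrib distrib_right)
  moreover have "test \<epsilon> x - x / (x + y + \<epsilon>) * w x = x / (x + \<epsilon>) * w x * (y / (x + y + \<epsilon>))"
  proof -
    have "x + \<epsilon> \<noteq> 0" "x + y + \<epsilon> \<noteq> 0" using assms eps by auto
    then show ?thesis unfolding test_def by (simp add: divide_simps) (simp add: algebra_simps)
  qed
  ultimately show ?thesis by linarith
qed

text \<open>Only the summand \<open>y powr s / x powr lam\<close> of the lower kernel bound is kept.
  The variables separate because \<open>x + y + \<epsilon> \<le> (1 + x) * (y + 2)\<close> for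
  \<open>\<epsilon> \<le> 1\<close>, which turns the bound into a function of \<open>x\<close> times
  the integrand of \<open>J\<close>.\<close>

lemma coagulation_integrand_le:
  assumes x: "x > 0" and y: "y > 0"
  shows "K x y * (test \<epsilon> (x + y) - test \<epsilon> x - test \<epsilon> y)
    \<le> - (c2 * (x powr (1 - lam) / ((x + \<epsilon>) * (1 + x)) * w x)) * (y powr s * (y / (y + 2)))"
proof -
  have "c2 * (y powr s / x powr lam) \<le> c2 * (x powr s / y powr lam + y powr s / x powr lam)"
    using c2_pos by (intro mult_left_mono) auto
  then have K: "c2 * (y powr s / x powr lam) \<le> K x y"
    using K_ge[OF x y] by (simp add: s_def)
  have "(1 + x) * (y + 2) = x * y + y + 2 * x + 2" by (simp add: algebra_simps)
  then have "x + y + \<epsilon> \<le> (1 + x) * (y + 2)"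
    using mult_pos_pos[OF x y] x eps by linarith
  then have "y / ((1 + x) * (y + 2)) \<le> y / (x + y + \<epsilon>)"
    using x y eps by (intro divide_left_mono) auto
  then have "x / (x + \<epsilon>) * w x * (y / ((1 + x) * (y + 2))) \<le> x / (x + \<epsilon>) * w x * (y / (x + y + \<epsilon>))"
    using x eps w_pos[OF x] by (intro mult_left_mono) auto
  also have "\<dots> \<le> test \<epsilon> x + test \<epsilon> y - test \<epsilon> (x + y)"
    by (rule test_subadditive_gap[OF x y])
  finally have gap: "x / (x + \<epsilon>) * w x * (y / ((1 + x) * (y + 2)))
    \<le> test \<epsilon> x + test \<epsilon> y - test \<epsilon> (x + y)" .
  have "c2 * (y powr s / x powr lam) * (x / (x + \<epsilon>) * w x * (y / ((1 + x) * (y + 2))))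
    \<le> K x y * (test \<epsilon> x + test \<epsilon> y - test \<epsilon> (x + y))"
    using K gap K_nonneg[OF x y] assms eps w_pos[OF x] by (intro mult_mono) auto
  moreover have "c2 * (y powr s / x powr lam) * (x / (x + \<epsilon>) * w x * (y / ((1 + x) * (y + 2))))
    = c2 * (x powr (1 - lam) / ((x + \<epsilon>) * (1 + x)) * w x) * (y powr s * (y / (y + 2)))"
    using x by (simp add: powr_diff mult_ac)
  ultimately show ?thesis by (simp add: algebra_simps)
qed

lemma integrable_loss: "integrable \<Phi> (\<lambda>x. x powr (1 - lam) / ((x + \<epsilon>) * (1 + x)) * w x)"
proof (rule integrable_Phi_bound)
  show "continuous_on {0<..} (\<lambda>x. x powr (1 - lam) / ((x + \<epsilon>) * (1 + x)) * w x)"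
    using eps by (intro continuous_intros) auto
  show "integrable \<Phi> (\<lambda>x. x powr (1 - lam) / \<epsilon>)" using integrable_lam by simp
  fix x :: real assume x: "x > 0"
  have "\<epsilon> * 1 \<le> (x + \<epsilon>) * (1 + x)" using x eps by (intro mult_mono) auto
  then have "x powr (1 - lam) / ((x + \<epsilon>) * (1 + x)) * w x \<le> x powr (1 - lam) / \<epsilon> * 1"
    using x eps w_pos[OF x] w_le_1[OF x] by (intro mult_mono frac_le) auto
  moreover have "0 \<le> x powr (1 - lam) / ((x + \<epsilon>) * (1 + x)) * w x"
    using x eps w_pos[OF x] by simp
  ultimately show "\<bar>x powr (1 - lam) / ((x + \<epsilon>) * (1 + x)) * w x\<bar> \<le> x powr (1 - lam) / \<epsilon>"
    by (simp only: abs_of_nonneg mult_1_right)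
qed

lemma integrable_flux: "integrable \<Phi> (\<lambda>x. x powr s * (\<epsilon> / (x + \<epsilon>)\<^sup>2) * w x)"
proof (rule integrable_Phi_bound)
  show "continuous_on {0<..} (\<lambda>x. x powr s * (\<epsilon> / (x + \<epsilon>)\<^sup>2) * w x)"
    using eps by (intro continuous_intros) auto
  show "integrable \<Phi> (\<lambda>x. x powr s * (\<epsilon> / \<epsilon>\<^sup>2))" using integrable_s by simp
  fix x :: real assume x: "x > 0"
  have "x powr s * (\<epsilon> / (x + \<epsilon>)\<^sup>2) * w x \<le> x powr s * (\<epsilon> / \<epsilon>\<^sup>2) * 1"
    using x eps w_pos[OF x] w_le_1[OF x] by (intro mult_mono frac_le power_mono) auto
  moreover have "0 \<le> x powr s * (\<epsilon> / (x + \<epsilon>)\<^sup>2) * w x"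
    using x eps w_pos[OF x] by simp
  ultimately show "\<bar>x powr s * (\<epsilon> / (x + \<epsilon>)\<^sup>2) * w x\<bar> \<le> x powr s * (\<epsilon> / \<epsilon>\<^sup>2)"
    by (simp only: abs_of_nonneg mult_1_right)
qed

text \<open>The linear drift and the mass term combine to a nonnegative multiple of
  \<open>x * test' \<epsilon> x + b * test \<epsilon> x\<close>. In the remaining flux term the part
  of \<open>test'\<close> due to the decay of \<open>w\<close> has a favourable sign and is
  dropped.\<close>

lemma drift_ge:
  assumes x: "x > 0"
  shows "- (1 / M) * (x powr s * (\<epsilon> / (x + \<epsilon>)\<^sup>2) * w x)
    \<le> test' \<epsilon> x * (2 / (1 - \<gamma>) * x - x powr s / M) - (1 + \<gamma>) / (1 - \<gamma>) * test \<epsilon> x"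
proof -
  have t: "0 \<le> test \<epsilon> x" by (rule test_nonneg[OF x])
  \<comment> \<open>Adding \<open>b * test \<epsilon> x\<close> cancels the constant
    \<open>b\<close> here and leaves two nonnegative summands.\<close>
  have "b * (x / (1 + x)) = b - b / (1 + x)"
    using x by (simp add: field_simps)
  then have xt: "x * test' \<epsilon> x + b * test \<epsilon> x = test \<epsilon> x * (\<epsilon> / (x + \<epsilon>) + b / (1 + x))"
    unfolding mult_test'_eq[OF x] by (simp only: distrib_left right_diff_distrib mult.commute)
  have "0 \<le> x * test' \<epsilon> x + b * test \<epsilon> x"
    unfolding xt using t x eps b_nonneg by simp
  then have "0 \<le> 2 / (1 - \<gamma>) * (x * test' \<epsilon> x + b * test \<epsilon> x)"
    using gamma_le by (intro mult_nonneg_nonneg) auto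
  moreover have "2 / (1 - \<gamma>) * (x * test' \<epsilon> x + b * test \<epsilon> x)
      = test' \<epsilon> x * (2 / (1 - \<gamma>) * x) + 2 * b / (1 - \<gamma>) * test \<epsilon> x"
    by (simp add: distrib_left mult_ac)
  moreover have "2 * b = - (1 + \<gamma>)" by (simp add: b_def)
  then have "2 * b / (1 - \<gamma>) = - ((1 + \<gamma>) / (1 - \<gamma>))"
    by (simp only: minus_divide_left)
  moreover have "test' \<epsilon> x * (x powr s / M) \<le> 1 / M * (x powr s * (\<epsilon> / (x + \<epsilon>)\<^sup>2) * w x)"
  proof -
    have "test' \<epsilon> x \<le> test \<epsilon> x * (\<epsilon> / (x * (x + \<epsilon>)))"
      unfolding test'_def using t x b_nonneg by (intro mult_left_mono) auto
    also have "\<dots> = \<epsilon> / (x + \<epsilon>)\<^sup>2 * w x"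
      using x by (simp add: test_def power2_eq_square)
    finally have "test' \<epsilon> x * (x powr s / M) \<le> \<epsilon> / (x + \<epsilon>)\<^sup>2 * w x * (x powr s / M)"
      using M_pos by (intro mult_right_mono) auto
    then show ?thesis by (simp add: mult_ac)
  qed
  ultimately show ?thesis by (simp only: right_diff_distrib mult_minus_left)
qed

text \<open>Integrating \<open>drift_ge\<close> bounds the left side of the weak equation below by
  \<open>- 1 / M\<close> times the flux. Integrating \<open>coagulation_integrand_le\<close> bounds
  the right side above by \<open>- c2 * J / 2\<close> times the loss. The equation links the
  two.\<close>

lemma flux_dominates_loss:
  "\<kappa> * (\<integral>x. x powr (1 - lam) / ((x + \<epsilon>) * (1 + x)) * w x \<partial>\<Phi>)
    \<le> (\<integral>x. x powr s * (\<epsilon> / (x + \<epsilon>)\<^sup>2) * w x \<partial>\<Phi>)"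
proof -
  let ?l = "\<lambda>x. x powr (1 - lam) / ((x + \<epsilon>) * (1 + x)) * w x"
  let ?g = "\<lambda>x. x powr s * (\<epsilon> / (x + \<epsilon>)\<^sup>2) * w x"
  let ?I = "\<lambda>x. \<integral>y. K x y * (test \<epsilon> (x + y) - test \<epsilon> x - test \<epsilon> y) \<partial>\<Phi>"
  let ?d = "\<lambda>x. test' \<epsilon> x * (2 / (1 - \<gamma>) * x - x powr s / M)"
  note defect = subadditivity_defect_bound[OF DERIV_test[OF eps(1)] test_bounds(3,1)]
  note cont = continuous_on_test[OF eps(1)] continuous_on_test'[OF eps(1)]
  have int_test: "integrable \<Phi> (test \<epsilon>)"
    by (rule integrable_Phi_bound[OF cont(1) _ test_bounds(2)]) (use integrable_s in simp)
  have int_x: "integrable \<Phi> (\<lambda>x. x * test' \<epsilon> x)"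
    by (rule integrable_Phi_bound[OF continuous_on_mult[OF continuous_on_id cont(2)] _ test_bounds(4)])
       (use integrable_s in simp)
  have int_s: "integrable \<Phi> (\<lambda>x. x powr s * test' \<epsilon> x)"
  proof (rule integrable_Phi_bound)
    show "continuous_on {0<..} (\<lambda>x. x powr s * test' \<epsilon> x)"
      by (intro continuous_on_mult continuous_on_powr_pos cont)
    show "integrable \<Phi> (\<lambda>x. x powr s * ((1 + b) / \<epsilon>))"
      using integrable_s by (rule integrable_mult_left)
    show "\<bar>x powr s * test' \<epsilon> x\<bar> \<le> x powr s * ((1 + b) / \<epsilon>)" if "x > 0" for x
      unfolding abs_mult using test_bounds(3)[OF that] by (intro mult_mono) auto
  qed
  have "integrable \<Phi> (\<lambda>x. 2 / (1 - \<gamma>) * (x * test' \<epsilon> x) - 1 / M * (x powr s * test' \<epsilon> x))"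
    by (intro Bochner_Integration.integrable_diff integrable_mult_right int_x int_s)
  then have int_d: "integrable \<Phi> ?d" by (simp add: algebra_simps)
  have inner: "?I x \<le> - (c2 * J) * ?l x" if x: "x > 0" for x
  proof -
    have "?I x \<le> (\<integral>y. - (c2 * ?l x) * (y powr s * (y / (y + 2))) \<partial>\<Phi>)"
      using coagulation_integrand_le[OF x]
      by (intro integral_mono integrable_mult_right integrable_J
          integrable_coagulation_integrand[OF cont(1) defect x]) (auto simp: space_Phi)
    also have "\<dots> = - (c2 * J) * ?l x"
      unfolding J_def by (subst integral_mult_right_zero) (simp only: mult_ac mult_minus_left mult_minus_right)
    finally show ?thesis .
  qed
  have "- (1 / M) * (\<integral>x. ?g x \<partial>\<Phi>) = (\<integral>x. - (1 / M) * ?g x \<partial>\<Phi>)"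
    by (rule integral_mult_right_zero[symmetric])
  also have "\<dots> \<le> (\<integral>x. ?d x - (1 + \<gamma>) / (1 - \<gamma>) * test \<epsilon> x \<partial>\<Phi>)"
    using drift_ge
    by (intro integral_mono integrable_mult_right integrable_flux int_d int_test
        Bochner_Integration.integrable_diff) (auto simp: space_Phi)
  also have "\<dots> = (\<integral>x. ?d x \<partial>\<Phi>) - (1 + \<gamma>) / (1 - \<gamma>) * (\<integral>x. test \<epsilon> x \<partial>\<Phi>)"
    using int_d int_test by simp
  also have "\<dots> = 1 / 2 * (\<integral>x. ?I x \<partial>\<Phi>)"
    by (rule weak_equation[OF DERIV_test[OF eps(1)] cont(2) test_bounds])
  also have "\<dots> \<le> 1 / 2 * (\<integral>x. - (c2 * J) * ?l x \<partial>\<Phi>)"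
    using inner
    by (intro mult_left_mono integral_mono integrable_mult_right integrable_loss
        integrable_coagulation_integral[OF cont(1) defect]) (auto simp: space_Phi)
  also have "\<dots> = - (c2 * J / 2) * (\<integral>x. ?l x \<partial>\<Phi>)"
    by (subst integral_mult_right_zero) simp
  finally have "c2 * J / 2 * (\<integral>x. ?l x \<partial>\<Phi>) \<le> 1 / M * (\<integral>x. ?g x \<partial>\<Phi>)"
    by simp
  then have "M * (c2 * J / 2 * (\<integral>x. ?l x \<partial>\<Phi>)) \<le> M * (1 / M * (\<integral>x. ?g x \<partial>\<Phi>))"
    using M_pos by (intro mult_left_mono) auto
  then show ?thesis using M_pos by (simp add: \<kappa>_def mult_ac)
qed

end

section \<open>Nonexistence\<close>

text \<open>The reduced loss is the loss at \<open>\<epsilon> = 1\<close>. As the loss decreases in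
  \<open>\<epsilon>\<close>, this is a positive lower bound valid for all admissible
  \<open>\<epsilon>\<close>, and the contradictions are drawn from it.\<close>

lemma integrable_reduced_loss: "integrable \<Phi> (\<lambda>x. x powr (1 - lam) / (1 + x)\<^sup>2 * w x)"
proof -
  have "(\<lambda>x. x powr (1 - lam) / ((x + 1) * (1 + x)) * w x) = (\<lambda>x. x powr (1 - lam) / (1 + x)\<^sup>2 * w x)"
    by (simp add: power2_eq_square add.commute)
  with integrable_loss[of 1] show ?thesis by simp
qed

lemma reduced_loss_pos: "0 < (\<integral>x. x powr (1 - lam) / (1 + x)\<^sup>2 * w x \<partial>\<Phi>)"
  by (rule integral_pos[OF integrable_reduced_loss]) (simp add: w_pos)

lemma reduced_loss_le_loss:
  assumes "0 < \<epsilon>" "\<epsilon> \<le> 1" "x > 0"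
  shows "x powr (1 - lam) / (1 + x)\<^sup>2 * w x \<le> x powr (1 - lam) / ((x + \<epsilon>) * (1 + x)) * w x"
proof -
  have "(x + \<epsilon>) * (1 + x) \<le> (1 + x)\<^sup>2"
    unfolding power2_eq_square using assms by (intro mult_right_mono) auto
  then show ?thesis
    using assms w_pos[of x] by (intro mult_right_mono divide_left_mono) auto
qed

text \<open>Below a threshold \<open>\<rho>\<close> the flux uses up at most half of the loss,
  thanks to the extra factor \<open>x powr \<delta>\<close>. Above \<open>\<rho>\<close> it is
  \<open>O(\<epsilon>)\<close>. The other half of the loss is at least \<open>\<kappa> / 2\<close>
  times the reduced loss, which would have to vanish.\<close>

lemma no_profile_supercritical:
  assumes "\<gamma> + 2 * lam > 1"
  shows False
proof -
  let ?l = "\<lambda>\<epsilon> x. x powr (1 - lam) / ((x + \<epsilon>) * (1 + x)) * w x"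
  let ?g = "\<lambda>\<epsilon> x. x powr s * (\<epsilon> / (x + \<epsilon>)\<^sup>2) * w x"
  let ?T = "\<lambda>x. x powr (1 - lam) / (1 + x)\<^sup>2 * w x"
  define \<delta> where "\<delta> = \<gamma> + 2 * lam - 1"
  have \<delta>: "\<delta> > 0" using assms by (simp add: \<delta>_def)
  \<comment> \<open>The target is \<open>\<rho> powr \<delta> \<le> \<kappa> / 4\<close>: the
    comparison of \<open>\<epsilon> / (x + \<epsilon>)\<^sup>2\<close> with the denominator of the
    loss costs a factor \<open>2\<close>, and the flux shall take a share of
    \<open>\<kappa> / 2\<close>.\<close>
  define \<rho> where "\<rho> = min 1 ((\<kappa> / 4) powr (1 / \<delta>))"
  have \<rho>: "0 < \<rho>" "\<rho> \<le> 1" using kappa_pos by (auto simp: \<rho>_def)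
  have "\<rho> powr \<delta> \<le> ((\<kappa> / 4) powr (1 / \<delta>)) powr \<delta>"
    using \<delta> \<rho>(1) by (intro powr_mono2) (auto simp: \<rho>_def)
  then have \<rho>_\<delta>: "\<rho> powr \<delta> \<le> \<kappa> / 4"
    using \<delta> kappa_pos by (simp add: powr_powr)
  have pointwise: "\<kappa> / 2 * ?T x - \<epsilon> / \<rho>\<^sup>2 * x powr s \<le> \<kappa> * ?l \<epsilon> x - ?g \<epsilon> x"
    if \<epsilon>: "0 < \<epsilon>" "\<epsilon> \<le> 1" and x: "x > 0" for \<epsilon> x
  proof -
    have T: "?T x \<le> ?l \<epsilon> x" by (rule reduced_loss_le_loss[OF \<epsilon> x])
    show ?thesis
    proof (cases "x \<le> \<rho>")
      case True
      have "x powr s = x powr (1 - lam) * x powr \<delta>"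
        by (simp add: s_def \<delta>_def add.commute flip: powr_add)
      also have "\<dots> \<le> x powr (1 - lam) * (\<kappa> / 4)"
        using powr_mono2[of \<delta> x \<rho>] \<delta> x True \<rho>_\<delta> by (intro mult_left_mono) auto
      finally have xs: "x powr s \<le> x powr (1 - lam) * (\<kappa> / 4)" .
      have "\<epsilon> * x \<le> 1 * x" using \<epsilon> x by (intro mult_right_mono) auto
      then have "\<epsilon> * (1 + x) \<le> (x + \<epsilon>) * 2"
        unfolding distrib_left distrib_right using \<epsilon> x by linarith
      then have "\<epsilon> / (x + \<epsilon>) \<le> 2 / (1 + x)"
        using x \<epsilon> by (simp add: pos_divide_le_eq pos_le_divide_eq mult_ac)
      then have "\<epsilon> / (x + \<epsilon>) / (x + \<epsilon>) \<le> 2 / (1 + x) / (x + \<epsilon>)"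
        using x \<epsilon> by (intro divide_right_mono) auto
      then have "\<epsilon> / (x + \<epsilon>)\<^sup>2 \<le> 2 / ((x + \<epsilon>) * (1 + x))"
        by (simp add: power2_eq_square mult_ac)
      then have "?g \<epsilon> x \<le> x powr (1 - lam) * (\<kappa> / 4) * (2 / ((x + \<epsilon>) * (1 + x))) * w x"
        using xs \<epsilon> x kappa_pos w_pos[OF x] by (intro mult_right_mono mult_mono) auto
      also have "\<dots> = \<kappa> / 2 * ?l \<epsilon> x"
      proof -
        have "P * (\<kappa> / 4) * (2 / d) * v = \<kappa> / 2 * (P / d * v)" for P d v :: real by simp
        then show ?thesis .
      qed
      finally have "?g \<epsilon> x \<le> \<kappa> / 2 * ?l \<epsilon> x" .
      moreover have "\<kappa> / 2 * ?T x \<le> \<kappa> / 2 * ?l \<epsilon> x"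
        using T kappa_pos by (intro mult_left_mono) auto
      moreover have "0 \<le> \<epsilon> / \<rho>\<^sup>2 * x powr s" using \<epsilon> by simp
      moreover have "\<kappa> * ?l \<epsilon> x = \<kappa> / 2 * ?l \<epsilon> x + \<kappa> / 2 * ?l \<epsilon> x"
        unfolding distrib_right[symmetric] by simp
      ultimately show ?thesis by linarith
    next
      case False
      \<comment> \<open>Away from the origin
        \<open>(x + \<epsilon>)\<^sup>2 \<ge> \<rho>\<^sup>2\<close>, so the flux is small and
        nothing has to be absorbed.\<close>
      have "?g \<epsilon> x \<le> x powr s * (\<epsilon> / \<rho>\<^sup>2) * 1"
        using False \<epsilon> x \<rho> w_pos[OF x] w_le_1[OF x]
        by (intro mult_mono frac_le power_mono) auto
      moreover have "\<kappa> / 2 * ?T x \<le> \<kappa> * ?l \<epsilon> x"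
        by (rule mult_mono[OF _ T]) (use kappa_pos w_pos[OF x] in simp_all)
      ultimately show ?thesis by (simp only: mult_1_right mult.commute)
    qed
  qed
  let ?L = "\<kappa> / 2 * (\<integral>x. ?T x \<partial>\<Phi>)"
  have main: "?L \<le> \<epsilon> * (M / \<rho>\<^sup>2)" if \<epsilon>: "0 < \<epsilon>" "\<epsilon> \<le> 1" for \<epsilon>
  proof -
    note int = integrable_mult_right[OF integrable_reduced_loss, of "\<kappa> / 2"]
      integrable_mult_right[OF integrable_s, of "\<epsilon> / \<rho>\<^sup>2"]
      integrable_mult_right[OF integrable_loss[OF \<epsilon>], of \<kappa>] integrable_flux[OF \<epsilon>]
    have "(\<integral>x. \<kappa> / 2 * ?T x - \<epsilon> / \<rho>\<^sup>2 * x powr s \<partial>\<Phi>) \<le> (\<integral>x. \<kappa> * ?l \<epsilon> x - ?g \<epsilon> x \<partial>\<Phi>)"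
      using pointwise[OF \<epsilon>]
      by (intro integral_mono Bochner_Integration.integrable_diff int) (auto simp: space_Phi)
    also have "\<dots> = \<kappa> * (\<integral>x. ?l \<epsilon> x \<partial>\<Phi>) - (\<integral>x. ?g \<epsilon> x \<partial>\<Phi>)"
      by (subst Bochner_Integration.integral_diff[OF int(3,4)]) (subst integral_mult_right_zero, rule refl)
    also have "\<dots> \<le> 0" using flux_dominates_loss[OF \<epsilon>] by simp
    finally have "(\<integral>x. \<kappa> / 2 * ?T x \<partial>\<Phi>) - (\<integral>x. \<epsilon> / \<rho>\<^sup>2 * x powr s \<partial>\<Phi>) \<le> 0"
      by (subst (asm) Bochner_Integration.integral_diff[OF int(1,2)])
    then have "?L - \<epsilon> / \<rho>\<^sup>2 * M \<le> 0"
      unfolding integral_mult_right_zero M_def .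
    then show ?thesis by simp
  qed
  have "(\<lambda>n. 1 / real (Suc n) * (M / \<rho>\<^sup>2)) \<longlonglongrightarrow> 0 * (M / \<rho>\<^sup>2)"
    by (intro tendsto_intros LIMSEQ_Suc lim_const_over_n)
  then have "?L \<le> 0 * (M / \<rho>\<^sup>2)"
    by (rule LIMSEQ_le_const) (intro exI allI impI main; simp)
  with reduced_loss_pos kappa_pos show False by (simp add: mult_le_0_iff)
qed

text \<open>Now \<open>s = 1 - lam\<close>, so the flux has no spare power to be absorbed by the
  loss. Instead it tends to \<open>0\<close> by dominated convergence: its integrand is at most
  \<open>x powr s / x\<close>, which is \<open>x powr (- lam)\<close> near the origin, and this is
  integrable by the additional moment.\<close>

lemma no_profile_critical:
  assumes crit: "\<gamma> + 2 * lam = 1"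
    and fin: "(\<integral>\<^sup>+ x\<in>{0<..1}. ennreal (x powr (- lam)) \<partial>\<Phi>) < \<infinity>"
  shows False
proof -
  let ?l = "\<lambda>\<epsilon> x. x powr (1 - lam) / ((x + \<epsilon>) * (1 + x)) * w x"
  let ?g = "\<lambda>\<epsilon> x. x powr s * (\<epsilon> / (x + \<epsilon>)\<^sup>2) * w x"
  let ?h = "\<lambda>x. x powr (- lam) * indicator {0<..1} x :: real"
  let ?e = "\<lambda>n. 1 / real (Suc n)"
  let ?L = "\<kappa> * (\<integral>x. x powr (1 - lam) / (1 + x)\<^sup>2 * w x \<partial>\<Phi>)"
  have s: "s = 1 - lam" using crit by (simp add: s_def)
  have e: "0 < ?e n" "?e n \<le> 1" for n by auto
  have e_lim: "?e \<longlonglongrightarrow> 0" by (intro LIMSEQ_Suc lim_const_over_n)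
  have main: "?L \<le> (\<integral>x. ?g (?e n) x \<partial>\<Phi>)" for n
  proof -
    have "?L \<le> \<kappa> * (\<integral>x. ?l (?e n) x \<partial>\<Phi>)"
      using kappa_pos reduced_loss_le_loss[OF e]
      by (intro mult_left_mono integral_mono integrable_reduced_loss integrable_loss e)
         (auto simp only: space_Phi greaterThan_iff)
    also have "\<dots> \<le> (\<integral>x. ?g (?e n) x \<partial>\<Phi>)" by (rule flux_dominates_loss[OF e])
    finally show ?thesis .
  qed
  have int_h: "integrable \<Phi> ?h"
  proof (rule integrableI_nonneg)
    show "?h \<in> borel_measurable \<Phi>"
      by (intro borel_measurable_times borel_measurable_Phi continuous_on_powr_pos borel_measurable_indicator)
         (auto simp: sets_Phi sets_restrict_space_iff)
    have "(\<integral>\<^sup>+ x. ennreal (?h x) \<partial>\<Phi>) = (\<integral>\<^sup>+ x\<in>{0<..1}. ennreal (x powr (- lam)) \<partial>\<Phi>)"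
      by (intro nn_integral_cong) (auto simp: indicator_def)
    with fin show "(\<integral>\<^sup>+ x. ennreal (?h x) \<partial>\<Phi>) < \<infinity>" by simp
  qed auto
  have "(\<lambda>n. \<integral>x. ?g (?e n) x \<partial>\<Phi>) \<longlonglongrightarrow> (\<integral>x. 0 \<partial>\<Phi>)"
  proof (rule integral_dominated_convergence)
    show "integrable \<Phi> (\<lambda>x. ?h x + x powr s)"
      using int_h integrable_s by (rule Bochner_Integration.integrable_add)
    show "?g (?e n) \<in> borel_measurable \<Phi>" for n
      by (rule borel_measurable_integrable[OF integrable_flux[OF e]])
    show "AE x in \<Phi>. norm (?g (?e n) x) \<le> ?h x + x powr s" for n
    proof (rule AE_Phi_pos)
      fix x :: real assume x: "x > 0"
      define \<epsilon> where "\<epsilon> = ?e n"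
      have \<epsilon>: "0 < \<epsilon>" "\<epsilon> \<le> 1" using e by (simp_all add: \<epsilon>_def)
      \<comment> \<open>This makes the majorant uniform in \<open>\<epsilon>\<close>:
        \<open>\<epsilon> / (x + \<epsilon>)\<^sup>2 \<le> 1 / x\<close>.\<close>
      have "\<epsilon> * x \<le> (x + \<epsilon>) * (x + \<epsilon>)" using \<epsilon> x by (intro mult_mono) auto
      then have "\<epsilon> / (x + \<epsilon>)\<^sup>2 \<le> 1 / x"
        using \<epsilon> x by (simp add: power2_eq_square pos_divide_le_eq pos_le_divide_eq)
      then have "?g \<epsilon> x \<le> x powr s * (1 / x) * 1"
        using x \<epsilon> w_pos[OF x] w_le_1[OF x] by (intro mult_mono mult_left_mono) auto
      also have "\<dots> \<le> ?h x + x powr s"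
      proof (cases "x \<le> 1")
        case True
        then show ?thesis using x by (simp add: s powr_diff powr_minus_divide)
      next
        case False
        then have "x powr s * (1 / x) \<le> x powr s * 1" by (intro mult_left_mono) auto
        with False show ?thesis by simp
      qed
      finally have "?g \<epsilon> x \<le> ?h x + x powr s" .
      moreover have "0 \<le> ?g \<epsilon> x" using x \<epsilon> w_pos[OF x] by simp
      ultimately show "norm (?g (?e n) x) \<le> ?h x + x powr s"
        unfolding \<epsilon>_def real_norm_def by (simp only: abs_of_nonneg)
    qed
    show "AE x in \<Phi>. (\<lambda>n. ?g (?e n) x) \<longlonglongrightarrow> 0"
    proof (rule AE_Phi_pos)
      fix x :: real assume x: "x > 0"
      have "(\<lambda>n. ?g (?e n) x) \<longlonglongrightarrow> x powr s * (0 / (x + 0)\<^sup>2) * w x"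
        using x by (intro tendsto_intros e_lim) auto
      then show "(\<lambda>n. ?g (?e n) x) \<longlonglongrightarrow> 0" by simp
    qed
  qed simp
  then have "?L \<le> (\<integral>x. 0 \<partial>\<Phi>)"
    by (rule LIMSEQ_le_const) (intro exI allI impI main)
  with reduced_loss_pos kappa_pos show False by (simp add: mult_le_0_iff)
qed

end

theorem theorem3p5:
  fixes \<gamma> lam :: real and K :: "real \<Rightarrow> real \<Rightarrow> real"
  assumes "\<gamma> < 1" and "\<gamma> + lam < 1"
    and "coagulation_kernel \<gamma> lam K"
  shows "(\<gamma> \<le> -1 \<and> \<gamma> + 2 * lam > 1 \<longrightarrow>
            \<not> (\<exists>\<Phi>. self_similar_profile \<gamma> lam K \<Phi>)) \<and>
         (\<gamma> \<le> -1 \<and> \<gamma> + 2 * lam = 1 \<longrightarrow>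
            \<not> (\<exists>\<Phi>. self_similar_profile \<gamma> lam K \<Phi> \<and>
                  (\<integral>\<^sup>+ x\<in>{0<..1}. ennreal (x powr (- lam)) \<partial>\<Phi>) < \<infinity>))"
proof -
  from assms(3) obtain c1 c2 where c2: "0 < c2" and bounds: "\<forall>x>0. \<forall>y>0.
      c2 * (x powr (\<gamma> + lam) / y powr lam + y powr (\<gamma> + lam) / x powr lam) \<le> K x y \<and>
      K x y \<le> c1 * (x powr (\<gamma> + lam) / y powr lam + y powr (\<gamma> + lam) / x powr lam)"
    unfolding coagulation_kernel_def by (elim conjE exE)
  \<comment> \<open>Both cases satisfy \<open>\<gamma> + 2 * lam \<ge> 1\<close>, so one instance of
    the locale serves them.\<close>
  have profile: "self_similar \<gamma> lam c1 c2 K \<Phi>"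
    if "\<gamma> \<le> -1" "\<gamma> + 2 * lam \<ge> 1" "self_similar_profile \<gamma> lam K \<Phi>" for \<Phi>
  proof
    show "continuous_on ({0<..} \<times> {0<..}) (\<lambda>(x, y). K x y)"
      using assms(3) by (simp add: coagulation_kernel_def)
  qed (use that assms c2 bounds in simp_all)
  show ?thesis
  proof (intro conjI impI notI; elim conjE exE)
    fix \<Phi> assume "\<gamma> \<le> -1" "\<gamma> + 2 * lam > 1" "self_similar_profile \<gamma> lam K \<Phi>"
    then show False
      using self_similar.no_profile_supercritical[OF profile[of \<Phi>]] by simp
  next
    fix \<Phi> assume "\<gamma> \<le> -1" "\<gamma> + 2 * lam = 1" "self_similar_profile \<gamma> lam K \<Phi>"
      "(\<integral>\<^sup>+ x\<in>{0<..1}. ennreal (x powr (- lam)) \<partial>\<Phi>) < \<infinity>"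
    then show False
      using self_similar.no_profile_critical[OF profile[of \<Phi>]] by simp
  qed
qed

end
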